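(* Let $\mathsf{A}\in\mathbb{R}^{J_1\times J_1\times\cdots\times J_N\times J_N}$ and suppose that a higher-order singular value decomposition (HOSVD) of $\mathsf{A}$ is given, with $n$-mode singular values $\gamma^{(n)}_j$. Consider the unforced multilinear time-invariant system $\mathsf{X}_{t+1}=\mathsf{A}*\mathsf{X}_t$, $\mathsf{X}_t\in\mathbb{R}^{J_1\times\cdots\times J_N}$. If for some $n\in\{1,\dots,2N\}$ the sum of squares of the $n$-mode singular values satisfies $\sum_j(\gamma_j^{(n)})^2<1$, then the equilibrium point $\mathsf{X}=\mathsf{O}$ is asymptotically stable.
   Context: The Einstein product of $\mathsf{A}\in\mathbb{R}^{J_1\times J_1\times\cdots\times J_N\times J_N}$ (entries $\mathsf{A}_{j_1i_1\cdots j_Ni_N}$) with $\mathsf{X}\in\mathbb{R}^{J_1\times\cdots\times J_N}$ is $(\mathsf{A}*\mathsf{X})_{j_1\cdots j_N}=\sum_{i_1}\cdots\sum_{i_N}\mathsf{A}_{j_1i_1\cdots j_Ni_N}\mathsf{X}_{i_1\cdots i_N}$. $\|\cdot\|$ is the Frobenius norm and $\mathsf{O}$ the zero tensor. The equilibrium $\mathsf{X}=\mathsf{O}$ is asymptotically stable if $\|\mathsf{X}_t\|\to0$ as $t\to\infty$ for every initial condition $\mathsf{X}_0$. HOSVD: a tensor $\mathsf{Y}\in\mathbb{R}^{L_1\times\cdots\times L_M}$ is written $\mathsf{Y}=\mathsf{S}\times_1\mathbf{U}_1\times_2\cdots\times_M\mathbf{U}_M$, with $\mathbf{U}_n\in\mathbb{R}^{L_n\times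 L_n}$ orthogonal, where $(\mathsf{S}\times_n\mathbf{U})_{l_1\cdots i\cdots l_M}=\sum_{l_n}\mathsf{S}_{l_1\cdots l_n\cdots l_M}\mathbf{U}_{il_n}$ ($i$ in position $n$), and $\mathsf{S}\in\mathbb{R}^{L_1\times\cdots\times L_M}$ is such that, writing $\mathsf{S}_{l_n=\alpha}$ for the subtensor obtained by fixing the $n$-th index to $\alpha$, (i) $\mathsf{S}_{l_n=\alpha}$ and $\mathsf{S}_{l_n=\beta}$ are orthogonal (in the entrywise inner product) for all $n$ and $\alpha\ne\beta$; (ii) $\|\mathsf{S}_{l_n=1}\|\ge\cdots\ge\|\mathsf{S}_{l_n=L_n}\|\ge0$ for all $n$. The $n$-mode singular values of $\mathsf{Y}$ are $\gamma^{(n)}_j=\|\mathsf{S}_{l_n=j}\|$, $j=1,\dots,L_n$. Here $M=2N$ and $\mathsf{Y}=\mathsf{A}$. *)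

theory Defs
  imports "HOL-Analysis.L2_Norm" "Jordan_Normal_Form.Matrix"
begin

text \<open>
  A real tensor of size \<open>L = [L\<^sub>1, \<dots>, L\<^sub>M]\<close> is a function on multi-indices, i.e. lists of
  length \<open>M\<close>. Modes and index values are counted from 0. Values of the function at lists outside
  \<open>multi_indices L\<close> are junk: no notion below depends on them.
\<close>

type_synonym tensor = "nat list \<Rightarrow> real"

definition multi_indices :: "nat list \<Rightarrow> nat list set" where
  "multi_indices L = {is. list_all2 (<) is L}"

definition tensor_inner :: "nat list \<Rightarrow> tensor \<Rightarrow> tensor \<Rightarrow> real" where
  "tensor_inner L X Y = (\<Sum>is\<in>multi_indices L. X is * Y is)"

definition tensor_norm :: "nat list \<Rightarrow> tensor \<Rightarrow> real" where
  "tensor_norm L X = L2_set X (multi_indices L)"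

text \<open>
  \<open>A\<close> has size \<open>splice J J = [J\<^sub>1, J\<^sub>1, \<dots>, J\<^sub>N, J\<^sub>N]\<close>, and for lists of equal length
  \<open>splice js is = [j\<^sub>1, i\<^sub>1, \<dots>, j\<^sub>N, i\<^sub>N]\<close>.
\<close>

definition einstein_prod :: "nat list \<Rightarrow> tensor \<Rightarrow> tensor \<Rightarrow> tensor" where
  "einstein_prod J A X = (\<lambda>js. \<Sum>is\<in>multi_indices J. A (splice js is) * X is)"

definition mode_prod :: "tensor \<Rightarrow> nat \<Rightarrow> real mat \<Rightarrow> tensor" where
  "mode_prod T n V = (\<lambda>is. \<Sum>l<dim_col V. T (is[n := l]) * V $$ (is ! n, l))"

text \<open>\<open>S \<times>\<^sub>1 U\<^sub>1 \<times>\<^sub>2 \<dots> \<times>\<^sub>M U\<^sub>M\<close>, associated to the left.\<close>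

definition multi_mode_prod :: "nat \<Rightarrow> tensor \<Rightarrow> (nat \<Rightarrow> real mat) \<Rightarrow> tensor" where
  "multi_mode_prod M S U = foldl (\<lambda>T n. mode_prod T n (U n)) S [0..<M]"

text \<open>Fixing the \<open>n\<close>-th index gives a tensor of order \<open>M - 1\<close>, of the following size.\<close>

definition subtensor_size :: "nat list \<Rightarrow> nat \<Rightarrow> nat list" where
  "subtensor_size L n = take n L @ drop (Suc n) L"

definition subtensor :: "tensor \<Rightarrow> nat \<Rightarrow> nat \<Rightarrow> tensor" where
  "subtensor S n \<alpha> = (\<lambda>is. S (take n is @ \<alpha> # drop n is))"

definition mode_singular_value :: "nat list \<Rightarrow> tensor \<Rightarrow> nat \<Rightarrow> nat \<Rightarrow> real" where
  "mode_singular_value L S n j = tensor_norm (subtensor_size L n) (subtensor S n j)"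

text \<open>
  Orthogonality of \<open>U n\<close> is spelled out because \<open>orthogonal_mat\<close> of the matrix library only asks
  for nonzero, pairwise orthogonal columns.
\<close>

definition is_hosvd :: "nat list \<Rightarrow> tensor \<Rightarrow> tensor \<Rightarrow> (nat \<Rightarrow> real mat) \<Rightarrow> bool" where
  "is_hosvd L Y S U \<longleftrightarrow>
     (\<forall>n<length L. U n \<in> carrier_mat (L ! n) (L ! n) \<and>
        transpose_mat (U n) * U n = 1\<^sub>m (L ! n) \<and> U n * transpose_mat (U n) = 1\<^sub>m (L ! n)) \<and>
     (\<forall>is\<in>multi_indices L. Y is = multi_mode_prod (length L) S U is) \<and>
     (\<forall>n<length L. \<forall>\<alpha><L ! n. \<forall>\<beta><L ! n. \<alpha> \<noteq> \<beta> \<longrightarrow>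
        tensor_inner (subtensor_size L n) (subtensor S n \<alpha>) (subtensor S n \<beta>) = 0) \<and>
     (\<forall>n<length L. \<forall>\<alpha>. Suc \<alpha> < L ! n \<longrightarrow>
        tensor_norm (subtensor_size L n) (subtensor S n (Suc \<alpha>))
          \<le> tensor_norm (subtensor_size L n) (subtensor S n \<alpha>))"

text \<open>\<open>X\<^sub>t\<^sub>+\<^sub>1 = A * X\<^sub>t\<close> as an identity of tensors of size \<open>J\<close>.\<close>

definition mlti_trajectory :: "nat list \<Rightarrow> tensor \<Rightarrow> (nat \<Rightarrow> tensor) \<Rightarrow> bool" where
  "mlti_trajectory J A X \<longleftrightarrow>
     (\<forall>t. \<forall>js\<in>multi_indices J. X (Suc t) js = einstein_prod J A (X t) js)"

text \<open>Every initial condition \<open>X 0\<close> is covered, since each is the start of a trajectory.\<close>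

lemma mlti_trajectory_exists: "\<exists>X. mlti_trajectory J A X \<and> X 0 = X0"
  by (rule exI[of _ "\<lambda>t. (einstein_prod J A ^^ t) X0"]) (simp add: mlti_trajectory_def)

definition asymptotically_stable :: "nat list \<Rightarrow> tensor \<Rightarrow> bool" where
  "asymptotically_stable J A \<longleftrightarrow>
     (\<forall>X. mlti_trajectory J A X \<longrightarrow> (\<lambda>t. tensor_norm J (X t)) \<longlonglongrightarrow> 0)"

end

theory Submission imports Defs "HOL-Analysis.Convex" begin

text \<open>
  The squared \<open>n\<close>-mode singular values are the squared norms of the slices of \<open>S\<close>, so they add up
  to \<open>\<parallel>S\<parallel>\<^sup>2\<close>, which equals \<open>\<parallel>A\<parallel>\<^sup>2\<close> because mode products with orthogonal matrices are isometries.
  By Cauchy-Schwarz \<open>\<parallel>A * X\<parallel> \<le> \<parallel>A\<parallel> \<parallel>X\<parallel>\<close>, so trajectories decay at least as fast as \<open>\<parallel>A\<parallel>\<^sup>t\<close>.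
\<close>

lemma finite_multi_indices [simp]: "finite (multi_indices L)"
proof (rule finite_subset)
  \<comment> \<open>A common bound on all entries reduces the claim to finiteness of the lists of
    fixed length over a finite set; inserting 0 keeps \<open>Max\<close> defined for
    \<open>L = []\<close>.\<close>
  show "multi_indices L \<subseteq> {xs. set xs \<subseteq> {..<Max (insert 0 (set L))} \<and> length xs = length L}"
  proof safe
    fix xs x assume xs: "xs \<in> multi_indices L"
    then show "length xs = length L"
      by (auto simp: multi_indices_def list_all2_lengthD)
    assume "x \<in> set xs"
    with xs obtain k where "k < length L" "x < L ! k"
      by (auto simp: multi_indices_def list_all2_conv_all_nth in_set_conv_nth)
    then show "x < Max (insert 0 (set L))"
      by (meson Max_ge finite_insert finite_set insertI2 nth_mem order_less_le_trans)
  qed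
qed (simp add: finite_lists_length_eq)

lemma tensor_norm_nonneg: "0 \<le> tensor_norm L X"
  by (simp add: tensor_norm_def)

lemma tensor_norm_power2: "(tensor_norm L X)\<^sup>2 = (\<Sum>i\<in>multi_indices L. (X i)\<^sup>2)"
  by (simp add: tensor_norm_def L2_set_def sum_nonneg)

lemma tensor_norm_cong:
  "(\<And>i. i \<in> multi_indices L \<Longrightarrow> X i = Y i) \<Longrightarrow> tensor_norm L X = tensor_norm L Y"
  by (simp add: tensor_norm_def cong: L2_set_cong)

lemma length_multi_index_subtensor_size:
  "n < length L \<Longrightarrow> i \<in> multi_indices (subtensor_size L n) \<Longrightarrow> Suc (length i) = length L"
  by (auto simp: multi_indices_def subtensor_size_def dest: list_all2_lengthD)

text \<open>Separates the mode-\<open>n\<close> index from the others, so that sums over a tensor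
  can be taken slice by slice or fibre by fibre. The inverse deletes entry \<open>n\<close> and
  records it.\<close>

lemma bij_betw_insert_index:
  assumes n: "n < length L"
  shows "bij_betw (\<lambda>(i, \<alpha>). take n i @ \<alpha> # drop n i)
    (multi_indices (subtensor_size L n) \<times> {..<L ! n}) (multi_indices L)"
proof (rule bij_betwI[where g = "\<lambda>i. (take n i @ drop (Suc n) i, i ! n)"])
  have L: "take n L @ L ! n # drop (Suc n) L = L"
    using n by (simp add: id_take_nth_drop[symmetric])
  show "(\<lambda>(i, \<alpha>). take n i @ \<alpha> # drop n i)
      \<in> multi_indices (subtensor_size L n) \<times> {..<L ! n} \<rightarrow> multi_indices L"
  proof clarify
    fix i \<alpha> assume i: "i \<in> multi_indices (subtensor_size L n)" and \<alpha>: "\<alpha> < L ! n"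
    have sub: "list_all2 (<) i (take n L @ drop (Suc n) L)"
      using i by (simp add: multi_indices_def subtensor_size_def)
    have "list_all2 (<) (take n i) (take n L)"
      using list_all2_takeI[OF sub, of n] n by simp
    moreover have "list_all2 (<) (drop n i) (drop (Suc n) L)"
      using list_all2_dropI[OF sub, of n] n by simp
    ultimately have "list_all2 (<) (take n i @ \<alpha> # drop n i) (take n L @ L ! n # drop (Suc n) L)"
      using \<alpha> by (intro list_all2_appendI) auto
    then show "take n i @ \<alpha> # drop n i \<in> multi_indices L"
      by (simp add: L multi_indices_def)
  qed
  show "(\<lambda>i. (take n i @ drop (Suc n) i, i ! n))
      \<in> multi_indices L \<rightarrow> multi_indices (subtensor_size L n) \<times> {..<L ! n}"
    using n by (auto simp: multi_indices_def subtensor_size_def list_all2_lengthD list_all2_nthD2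
        intro!: list_all2_appendI list_all2_takeI list_all2_dropI)
next
  fix p assume "p \<in> multi_indices (subtensor_size L n) \<times> {..<L ! n}"
  then obtain i \<alpha> where p: "p = (i, \<alpha>)" and i: "i \<in> multi_indices (subtensor_size L n)"
    by auto
  \<comment> \<open>For shorter \<open>i\<close> the inserted entry would not end up at position
    \<open>n\<close>.\<close>
  have "n \<le> length i"
    using length_multi_index_subtensor_size[OF n i] n by simp
  then show "(\<lambda>i. (take n i @ drop (Suc n) i, i ! n)) ((\<lambda>(i, \<alpha>). take n i @ \<alpha> # drop n i) p) = p"
    by (simp add: p nth_append min_def)
next
  fix i assume "i \<in> multi_indices L"
  then have "n < length i"
    using n by (auto simp: multi_indices_def dest: list_all2_lengthD)
  then show "(\<lambda>(i, \<alpha>). take n i @ \<alpha> # drop n i) (take n i @ drop (Suc n) i, i ! n) = i"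
    by (simp add: id_take_nth_drop[symmetric])
qed

lemma sum_multi_indices_subtensor:
  assumes "n < length L"
  shows "(\<Sum>i\<in>multi_indices L. f i) =
    (\<Sum>i\<in>multi_indices (subtensor_size L n). \<Sum>\<alpha><L ! n. f (take n i @ \<alpha> # drop n i))"
  by (simp add: sum.reindex_bij_betw[OF bij_betw_insert_index[OF assms], of f, symmetric]
      sum.cartesian_product case_prod_unfold)

lemma sum_mode_singular_value_power2:
  assumes "n < length L"
  shows "(\<Sum>j<L ! n. (mode_singular_value L S n j)\<^sup>2) = (tensor_norm L S)\<^sup>2"
  \<comment> \<open>Each entry of \<open>S\<close> lies in exactly one slice. The splitting has the
    mode-\<open>n\<close> index innermost, whereas \<open>j\<close> is outermost here, hence the
    swap.\<close>
  by (simp add: mode_singular_value_def tensor_norm_power2 subtensor_def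
      sum_multi_indices_subtensor[OF assms] sum.swap[of _ "{..<L ! n}"])

text \<open>The left side is the quadratic form of \<open>transpose_mat V * V\<close> at
  \<open>x\<close>, and that matrix is the identity.\<close>

lemma sum_power2_orthogonal_mat:
  fixes V :: "real mat" and x :: "nat \<Rightarrow> real"
  assumes V: "V \<in> carrier_mat d d" and orth: "transpose_mat V * V = 1\<^sub>m d"
  shows "(\<Sum>a<d. (\<Sum>l<d. x l * V $$ (a, l))\<^sup>2) = (\<Sum>l<d. (x l)\<^sup>2)"
proof -
  have gram: "(\<Sum>a<d. V $$ (a, l) * V $$ (a, m)) = (if l = m then 1 else 0)"
    if "l < d" "m < d" for l m
  proof -
    have "(transpose_mat V * V) $$ (l, m) = (\<Sum>a<d. V $$ (a, l) * V $$ (a, m))"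
      using V that by (simp add: scalar_prod_def atLeast0LessThan)
    then show ?thesis
      using that by (simp add: orth)
  qed
  \<comment> \<open>After expanding the square, the row index \<open>a\<close> is moved innermost,
    where its sum is an entry of the Gram matrix of the columns.\<close>
  have "(\<Sum>a<d. (\<Sum>l<d. x l * V $$ (a, l))\<^sup>2)
      = (\<Sum>a<d. \<Sum>l<d. \<Sum>m<d. x l * x m * (V $$ (a, l) * V $$ (a, m)))"
    by (simp add: power2_eq_square sum_product mult_ac)
  also have "\<dots> = (\<Sum>l<d. \<Sum>a<d. \<Sum>m<d. x l * x m * (V $$ (a, l) * V $$ (a, m)))"
    by (rule sum.swap)
  also have "\<dots> = (\<Sum>l<d. \<Sum>m<d. \<Sum>a<d. x l * x m * (V $$ (a, l) * V $$ (a, m)))"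
    by (intro sum.cong refl sum.swap)
  also have "\<dots> = (\<Sum>l<d. \<Sum>m<d. x l * x m * (if l = m then 1 else 0))"
    by (intro sum.cong refl) (simp add: sum_distrib_left[symmetric] gram)
  also have "\<dots> = (\<Sum>l<d. (x l)\<^sup>2)"
    by (intro sum.cong refl) (simp add: power2_eq_square if_distrib cong: if_cong)
  finally show ?thesis .
qed

text \<open>A mode-\<open>n\<close> product mixes only entries that differ in index
  \<open>n\<close>: on each such fibre it is multiplication by \<open>V\<close>, which preserves the
  sum of squares.\<close>

lemma tensor_norm_mode_prod:
  assumes n: "n < length L" and V: "V \<in> carrier_mat (L ! n) (L ! n)"
    and orth: "transpose_mat V * V = 1\<^sub>m (L ! n)"
  shows "tensor_norm L (mode_prod T n V) = tensor_norm L T"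
proof (rule power2_eq_imp_eq[OF _ tensor_norm_nonneg tensor_norm_nonneg])
  have fibre: "(\<Sum>\<alpha><L ! n. (mode_prod T n V (take n i @ \<alpha> # drop n i))\<^sup>2)
      = (\<Sum>\<alpha><L ! n. (T (take n i @ \<alpha> # drop n i))\<^sup>2)"
    if i: "i \<in> multi_indices (subtensor_size L n)" for i
  proof -
    have "n \<le> length i"
      using length_multi_index_subtensor_size[OF n i] n by simp
    then have "mode_prod T n V (take n i @ \<alpha> # drop n i)
        = (\<Sum>l<L ! n. T (take n i @ l # drop n i) * V $$ (\<alpha>, l))" for \<alpha>
      using V by (simp add: mode_prod_def list_update_append nth_append min_def)
    then show ?thesis
      by (simp add: sum_power2_orthogonal_mat[OF V orth])
  qed
  show "(tensor_norm L (mode_prod T n V))\<^sup>2 = (tensor_norm L T)\<^sup>2"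
    by (simp add: tensor_norm_power2 sum_multi_indices_subtensor[OF n] fibre)
qed

text \<open>\<open>M\<close> counts the modes already multiplied. Keeping it separate from
  \<open>length L\<close> allows induction on it with the size \<open>L\<close> fixed; each step
  appends one more isometry.\<close>

lemma tensor_norm_multi_mode_prod:
  assumes "\<And>n. n < M \<Longrightarrow> U n \<in> carrier_mat (L ! n) (L ! n)"
    and "\<And>n. n < M \<Longrightarrow> transpose_mat (U n) * U n = 1\<^sub>m (L ! n)"
    and "M \<le> length L"
  shows "tensor_norm L (multi_mode_prod M S U) = tensor_norm L S"
  using assms by (induction M) (simp_all add: multi_mode_prod_def tensor_norm_mode_prod)

lemma tensor_norm_hosvd:
  assumes "is_hosvd L Y S U"
  shows "tensor_norm L Y = tensor_norm L S"
proof -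
  have "tensor_norm L Y = tensor_norm L (multi_mode_prod (length L) S U)"
    using assms by (intro tensor_norm_cong) (simp add: is_hosvd_def)
  also have "\<dots> = tensor_norm L S"
    using assms by (intro tensor_norm_multi_mode_prod) (simp_all add: is_hosvd_def)
  finally show ?thesis .
qed

lemma splice_mem_multi_indices:
  assumes "js \<in> multi_indices J" "is \<in> multi_indices K" "length J = length K"
  shows "splice js is \<in> multi_indices (splice J K)"
proof -
  have "list_all2 (<) js J \<Longrightarrow> list_all2 (<) is K \<Longrightarrow> list_all2 (<) (splice js is) (splice J K)"
    using assms(3)
    by (induction J K arbitrary: js "is" rule: list_induct2) (auto simp: list_all2_Cons2)
  with assms show ?thesis
    by (simp add: multi_indices_def)
qed

text \<open>Interleaving can be undone only if the lengths are known to agree: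
  \<open>splice [x] [] = splice [] [x]\<close>.\<close>

lemma splice_inject:
  assumes "length xs = length ys" "length xs' = length ys'"
    and "splice xs ys = splice xs' ys'"
  shows "xs = xs' \<and> ys = ys'"
  using assms
proof (induction xs ys arbitrary: xs' ys' rule: list_induct2)
  case Nil
  then show ?case by (cases xs'; cases ys') auto
next
  case (Cons x xs y ys)
  then show ?case by (cases xs'; cases ys') auto
qed

text \<open>Reads \<open>A\<close> as a matrix with rows \<open>js\<close> and columns
  \<open>is\<close>: Cauchy-Schwarz bounds each entry of the product by its row, and the squared row
  norms add up to at most the squared norm of \<open>A\<close>.\<close>

lemma tensor_norm_einstein_prod_le:
  "tensor_norm J (einstein_prod J A X) \<le> tensor_norm (splice J J) A * tensor_norm J X"
proof (rule power2_le_imp_le)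
  let ?I = "multi_indices J"
  \<comment> \<open>Ensures that the double sum counts no entry of \<open>A\<close> twice.\<close>
  have inj: "inj_on (\<lambda>(js, is). splice js is) (?I \<times> ?I)"
    by (simp add: inj_on_def multi_indices_def) (metis list_all2_lengthD splice_inject)
  have "(\<Sum>js\<in>?I. \<Sum>is\<in>?I. (A (splice js is))\<^sup>2)
      = (\<Sum>k\<in>(\<lambda>(js, is). splice js is) ` (?I \<times> ?I). (A k)\<^sup>2)"
    unfolding sum.reindex[OF inj] by (simp add: sum.cartesian_product case_prod_unfold)
  \<comment> \<open>The image lies in the index set of \<open>A\<close>, and further squares can
    only increase the sum.\<close>
  also have "\<dots> \<le> (tensor_norm (splice J J) A)\<^sup>2"
    unfolding tensor_norm_power2
    by (rule sum_mono2) (auto intro: splice_mem_multi_indices)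
  finally have A: "(\<Sum>js\<in>?I. \<Sum>is\<in>?I. (A (splice js is))\<^sup>2) \<le> (tensor_norm (splice J J) A)\<^sup>2" .
  have "(tensor_norm J (einstein_prod J A X))\<^sup>2
      \<le> (\<Sum>js\<in>?I. (\<Sum>is\<in>?I. (A (splice js is))\<^sup>2) * (\<Sum>is\<in>?I. (X is)\<^sup>2))"
    unfolding tensor_norm_power2 einstein_prod_def
    by (intro sum_mono Cauchy_Schwarz_ineq_sum)
  also have "\<dots> = (\<Sum>js\<in>?I. \<Sum>is\<in>?I. (A (splice js is))\<^sup>2) * (tensor_norm J X)\<^sup>2"
    by (simp add: tensor_norm_power2 sum_distrib_right)
  also have "\<dots> \<le> (tensor_norm (splice J J) A * tensor_norm J X)\<^sup>2"
    unfolding power_mult_distrib by (intro mult_right_mono A) simp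
  finally show "(tensor_norm J (einstein_prod J A X))\<^sup>2
      \<le> (tensor_norm (splice J J) A * tensor_norm J X)\<^sup>2" .
qed (simp add: tensor_norm_nonneg)

text \<open>One time step scales the norm by at most \<open>tensor_norm (splice J J) A\<close>, so
  iteration gives geometric decay from any initial tensor.\<close>

lemma asymptotically_stable_if_tensor_norm_less_1:
  assumes "tensor_norm (splice J J) A < 1"
  shows "asymptotically_stable J A"
  unfolding asymptotically_stable_def
proof (intro allI impI)
  fix X assume traj: "mlti_trajectory J A X"
  let ?q = "tensor_norm (splice J J) A"
  have step: "tensor_norm J (X (Suc t)) \<le> ?q * tensor_norm J (X t)" for t
  proof -
    have "tensor_norm J (X (Suc t)) = tensor_norm J (einstein_prod J A (X t))"
      using traj by (intro tensor_norm_cong) (simp add: mlti_trajectory_def)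
    then show ?thesis
      by (simp add: tensor_norm_einstein_prod_le)
  qed
  have bound: "tensor_norm J (X t) \<le> ?q ^ t * tensor_norm J (X 0)" for t
  proof (induction t)
    case (Suc t)
    from step[of t] mult_left_mono[OF Suc tensor_norm_nonneg[of "splice J J" A]]
    show ?case by (simp add: mult.assoc)
  qed simp
  have lim: "(\<lambda>t. ?q ^ t * tensor_norm J (X 0)) \<longlonglongrightarrow> 0"
    using assms by (intro tendsto_mult_left_zero LIMSEQ_realpow_zero tensor_norm_nonneg)
  show "(\<lambda>t. tensor_norm J (X t)) \<longlonglongrightarrow> 0"
    by (rule tendsto_sandwich[OF _ _ tendsto_const lim]) (simp_all add: tensor_norm_nonneg bound)
qed

theorem corollary5p2:
  fixes N n :: nat and J :: "nat list" and A S :: tensor and U :: "nat \<Rightarrow> real mat"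
  assumes "N \<ge> 1" and "length J = N" and "\<forall>j\<in>set J. j \<ge> 1"
    and "is_hosvd (splice J J) A S U"
    and "n < 2 * N"
    and "(\<Sum>j<splice J J ! n. (mode_singular_value (splice J J) S n j)\<^sup>2) < 1"
  shows "asymptotically_stable J A"
proof (rule asymptotically_stable_if_tensor_norm_less_1)
  \<comment> \<open>Splicing \<open>J\<close> with itself doubles its length, so
    \<open>n < 2 * N\<close> ranges over exactly the modes of \<open>A\<close>.\<close>
  have "n < length (splice J J)"
    using assms(2,5) by simp
  then have "(tensor_norm (splice J J) A)\<^sup>2 < 1"
    using assms(6) by (simp add: tensor_norm_hosvd[OF assms(4)] sum_mode_singular_value_power2)
  then show "tensor_norm (splice J J) A < 1"
    by (simp add: abs_square_less_1)
qed

end
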